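(* Let $a\in\mathbb{R}$, $b,c>0$ with $b^2-24ac>0$ be fixed, and let $Q_0\in\mathcal{S}_0^{(3)}$. For $\xi>0$ let $Q_\xi$ be the solution of $$\frac{d}{dt}Q_\xi=DQ_\xi+Q_\xi D+\frac23D-2\left(Q_\xi+\tfrac13Id\right)\mathrm{tr}(Q_\xi D)+\frac1\xi\left([W,Q_\xi]-aQ_\xi+b\left(Q_\xi^2-\tfrac13|Q_\xi|^2Id\right)-cQ_\xi|Q_\xi|^2\right)$$ with $Q_\xi(0)=Q_0$, and let $R$ be the solution of $$\frac{d}{dt}R=DR+RD+\frac23D-2\left(R+\tfrac13Id\right)\mathrm{tr}(RD)$$ with $R(0)=Q_0$. Then there exists a time $T^*>0$, depending only on $|Q_0|$ (for fixed $a,b,c$) and independent of $\xi$, such that the solutions of both equations exist on $[0,T^*]$, and moreover $$\lim_{\xi\to\infty}\ \sup_{t\in[0,T^*]}|Q_\xi(t)-R(t)|=0 .$$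
   Context: $\mathcal{S}_0^{(3)}$ denotes the space of real symmetric traceless $3\times3$ matrices; $Id$ is the $3\times3$ identity matrix, $|Q|^2=\mathrm{tr}(Q^2)$ (Frobenius norm), $[W,Q]=WQ-QW$, and $$W=\begin{pmatrix}0&1&0\\-1&0&0\\0&0&0\end{pmatrix},\qquad D=\begin{pmatrix}0&1&0\\1&0&0\\0&0&0\end{pmatrix}.$$ *)

theory Defs
  imports "HOL-Analysis.Analysis"
begin

definition S0 :: "(real^3^3) set" where
  "S0 = {Q. transpose Q = Q \<and> trace Q = 0}"

text \<open>The library norm on \<^typ>\<open>real^3^3\<close> is the Frobenius norm; on symmetric matrices its
  square is the trace of \<open>Q\<^sup>2\<close>.\<close>

lemma norm_symmetric_eq_trace:
  fixes Q :: "real^3^3"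
  assumes "transpose Q = Q"
  shows "(norm Q)\<^sup>2 = trace (Q ** Q)"
proof -
  have "(norm Q)\<^sup>2 = (\<Sum>i\<in>UNIV. \<Sum>j\<in>UNIV. Q $ i $ j * Q $ i $ j)"
    by (simp add: power2_norm_eq_inner inner_vec_def)
  also have "\<dots> = trace (transpose Q ** Q)"
    unfolding trace_def matrix_matrix_mult_def transpose_def
    by (simp, rule sum.swap)
  finally show ?thesis using assms by simp
qed

definition Wmat :: "real^3^3" where
  "Wmat = vector [vector [0, 1, 0], vector [-1, 0, 0], vector [0, 0, 0]]"

definition Dmat :: "real^3^3" where
  "Dmat = vector [vector [0, 1, 0], vector [1, 0, 0], vector [0, 0, 0]]"

definition commutator :: "real^3^3 \<Rightarrow> real^3^3 \<Rightarrow> real^3^3" where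
  "commutator A B = A ** B - B ** A"

definition limit_field :: "real^3^3 \<Rightarrow> real^3^3" where
  "limit_field Q = Dmat ** Q + Q ** Dmat + (2/3) *\<^sub>R Dmat
     - (2 * trace (Q ** Dmat)) *\<^sub>R (Q + (1/3) *\<^sub>R mat 1)"

definition full_field :: "real \<Rightarrow> real \<Rightarrow> real \<Rightarrow> real \<Rightarrow> real^3^3 \<Rightarrow> real^3^3" where
  "full_field a b c \<xi> Q = limit_field Q
     + (1/\<xi>) *\<^sub>R (commutator Wmat Q - a *\<^sub>R Q
         + b *\<^sub>R (Q ** Q - ((1/3) * (norm Q)\<^sup>2) *\<^sub>R mat 1)
         - (c * (norm Q)\<^sup>2) *\<^sub>R Q)"

text \<open>The equations are posed on the phase space \<^const>\<open>S0\<close>. Derivatives at the end points of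
  \<open>[0, T]\<close> are one-sided.\<close>

definition solution_on ::
    "(real^3^3 \<Rightarrow> real^3^3) \<Rightarrow> real^3^3 \<Rightarrow> real \<Rightarrow> (real \<Rightarrow> real^3^3) \<Rightarrow> bool" where
  "solution_on F Q0 T Q \<longleftrightarrow> Q 0 = Q0 \<and>
     (\<forall>t\<in>{0..T}. Q t \<in> S0 \<and> (Q has_vector_derivative F (Q t)) (at t within {0..T}))"

text \<open>``The solution exists on \<open>[0, T]\<close>'': there is a solution on \<open>[0, T]\<close>, and every solution on
  a subinterval \<open>[0, S]\<close> is a restriction of it, so that the maximal solution is defined
  at least on \<open>[0, T]\<close>.\<close>

definition the_solution_exists_on :: "(real^3^3 \<Rightarrow> real^3^3) \<Rightarrow> real^3^3 \<Rightarrow> real \<Rightarrow> bool" where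
  "the_solution_exists_on F Q0 T \<longleftrightarrow>
     (\<exists>Q. solution_on F Q0 T Q \<and>
       (\<forall>S\<in>{0..T}. \<forall>Q'. solution_on F Q0 S Q' \<longrightarrow> (\<forall>t\<in>{0..S}. Q' t = Q t)))"

end

theory Submission
  imports Defs
begin

text \<open>
The rescaled terms carry the factor \<open>1/\<xi>\<close>, which is huge for small \<open>\<xi>\<close>. A lifespan that does not
depend on \<open>\<xi>\<close> therefore cannot come from the size of the field; it comes from the sign of its
radial part. For symmetric traceless \<open>Q\<close> the commutator is orthogonal to \<open>Q\<close>, and
\<open>-a|Q|\<^sup>2 + b tr(Q\<^sup>3) - c|Q|\<^sup>4\<close> is nonpositive as soon as \<open>|Q|\<close> exceeds a radius \<open>M\<close> determined by
\<open>a\<close>, \<open>b\<close>, \<open>c\<close> (\<open>relaxation_dissipative\<close>). With \<open>r = max |Q\<^sub>0| M\<close>, the scaled terms can only push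
inwards outside the ball of radius \<open>r\<close>, so every growth beyond \<open>r\<close> is due to the limit field, whose
norm on the ball of radius \<open>r + 1\<close> is at most some \<open>K\<close>. Hence \<open>|Q|\<close> grows at speed at most \<open>K\<close> there
(\<open>norm_barrier\<close>) and the solution stays in the ball of radius \<open>r + 1\<close> up to time \<open>1/K\<close>, for all
\<open>\<xi>\<close> at once. This is \<open>Tstar\<close>.

Existence follows by composing the polynomial field with a projection onto the part of the phase
space in that ball. The truncated field is globally Lipschitz, so it has a solution
(\<open>lipschitz_field_solution_exists\<close>); the barrier applies to it and shows that the truncation is
never felt. Uniqueness and convergence are both Gronwall estimates (\<open>gronwall_norm\<close>): on the common
ball the limit field is Lipschitz and the remaining terms are of size \<open>C/\<xi>\<close>, so the distance of the
two solutions is at most a constant times \<open>C/\<xi>\<close>.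
\<close>

section \<open>Differential inequalities\<close>

lemma nonincreasing_within:
  fixes f :: "real \<Rightarrow> real"
  assumes "a \<le> b"
    and "\<And>x. x \<in> {a..b} \<Longrightarrow> (f has_real_derivative f' x) (at x within {a..b})"
    and "\<And>x. x \<in> {a..b} \<Longrightarrow> f' x \<le> 0"
  shows "f b \<le> f a"
proof -
  have "\<exists>x\<in>{a..b}. f b - f a = f' x * (b - a)"
    using assms(2) by (intro mvt_very_simple[OF \<open>a \<le> b\<close>]) (auto simp: has_field_derivative_def)
  then obtain x where "x \<in> {a..b}" "f b - f a = f' x * (b - a)" ..
  with assms show ?thesis
    by (metis diff_ge_0_iff_ge diff_le_0_iff_le mult_nonpos_nonneg)
qed

text \<open>The square of the norm is differentiable even where \<open>z\<close> vanishes, so the estimate is carried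
out for \<open>|z|\<^sup>2\<close>. The cross term is absorbed by \<open>2 e |z| \<le> |z|\<^sup>2 + e\<^sup>2\<close>, which accounts for the
\<open>+ 1\<close> in the exponent; then \<open>exp (-(2L + 1) t) |z|\<^sup>2 - e\<^sup>2 t\<close> is nonincreasing.\<close>

lemma gronwall_norm:
  fixes z z' :: "real \<Rightarrow> 'a::real_inner"
  assumes der: "\<And>t. t \<in> {0..T} \<Longrightarrow> (z has_vector_derivative z' t) (at t within {0..T})"
    and bound: "\<And>t. t \<in> {0..T} \<Longrightarrow> norm (z' t) \<le> L * norm (z t) + e"
    and "L \<ge> 0" and z0: "z 0 = 0" and t: "t \<in> {0..T}"
  shows "(norm (z t))\<^sup>2 \<le> exp ((2 * L + 1) * t) * (e\<^sup>2 * t)"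
proof -
  define M where "M = 2 * L + 1"
  define v where "v = (\<lambda>s. exp (- M * s) * (z s \<bullet> z s) - e\<^sup>2 * s)"
  define v' where
    "v' = (\<lambda>s. exp (- M * s) * (2 * (z s \<bullet> z' s)) - M * exp (- M * s) * (z s \<bullet> z s) - e\<^sup>2)"
  have "v t \<le> v 0"
  proof (rule nonincreasing_within[where f = v and f' = v'])
    show "0 \<le> t" using t by simp
    fix s assume s: "s \<in> {0..t}"
    then have sT: "s \<in> {0..T}" using t by auto
    have "(z has_vector_derivative z' s) (at s within {0..t})"
      by (rule has_vector_derivative_within_subset[OF der[OF sT]]) (use t in auto)
    then have z: "(z has_derivative (\<lambda>h. h *\<^sub>R z' s)) (at s within {0..t})"
      by (simp add: has_vector_derivative_def)
    show "(v has_real_derivative v' s) (at s within {0..t})"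
      unfolding v_def v'_def has_field_derivative_def
      by (rule derivative_eq_intros z refl | simp)+
        (auto simp: fun_eq_iff algebra_simps inner_commute)
    have "z s \<bullet> z' s \<le> norm (z s) * norm (z' s)" by (rule norm_cauchy_schwarz)
    also have "\<dots> \<le> norm (z s) * (L * norm (z s) + e)"
      using bound[OF sT] by (intro mult_left_mono) auto
    finally have "2 * (z s \<bullet> z' s) \<le> M * (norm (z s))\<^sup>2 + e\<^sup>2 - (norm (z s) - e)\<^sup>2"
      by (simp add: M_def power2_eq_square algebra_simps)
    then have "2 * (z s \<bullet> z' s) - M * (z s \<bullet> z s) \<le> e\<^sup>2"
      by (simp add: power2_norm_eq_inner) (smt (verit) zero_le_power2)
    then have "exp (- M * s) * (2 * (z s \<bullet> z' s) - M * (z s \<bullet> z s)) \<le> exp (- M * s) * e\<^sup>2"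
      by (intro mult_left_mono) auto
    also have "\<dots> \<le> 1 * e\<^sup>2"
    proof (intro mult_right_mono)
      have "0 \<le> M * s" using s \<open>L \<ge> 0\<close> by (simp add: M_def)
      then show "exp (- M * s) \<le> 1" by simp
    qed simp
    finally show "v' s \<le> 0" by (simp add: v'_def algebra_simps)
  qed
  then have "exp (- M * t) * (norm (z t))\<^sup>2 \<le> e\<^sup>2 * t"
    by (simp add: v_def z0 power2_norm_eq_inner)
  then have "exp (M * t) * (exp (- M * t) * (norm (z t))\<^sup>2) \<le> exp (M * t) * (e\<^sup>2 * t)"
    by (intro mult_left_mono) auto
  moreover have "exp (M * t) * (exp (- M * t) * (norm (z t))\<^sup>2) = (norm (z t))\<^sup>2"
    by (simp add: mult.assoc[symmetric] exp_add[symmetric])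
  ultimately have "(norm (z t))\<^sup>2 \<le> exp (M * t) * (e\<^sup>2 * t)" by (simp only:)
  then show ?thesis by (simp add: M_def)
qed

text \<open>The speed limit is imposed only outside the ball of radius \<open>r\<close>; inside it the derivative may be
arbitrarily large. After the last time at which the barrier \<open>r + K s\<close> is respected, the curve stays
outside the ball, where its norm is differentiable with derivative at most \<open>K\<close>, so it cannot rise
above a barrier that climbs at speed \<open>K\<close>.\<close>

lemma norm_barrier:
  fixes z z' :: "real \<Rightarrow> 'a::real_inner"
  assumes der: "\<And>t. t \<in> {0..T} \<Longrightarrow> (z has_vector_derivative z' t) (at t within {0..T})"
    and out: "\<And>t. t \<in> {0..T} \<Longrightarrow> r \<le> norm (z t) \<Longrightarrow> z t \<bullet> z' t \<le> K * norm (z t)"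
    and "norm (z 0) \<le> r" "0 < r" "0 \<le> K" and t: "t \<in> {0..T}"
  shows "norm (z t) \<le> r + K * t"
proof (rule ccontr)
  assume above: "\<not> norm (z t) \<le> r + K * t"
  have cont: "continuous_on {0..t} z"
    by (rule continuous_on_vector_derivative, rule has_vector_derivative_within_subset[OF der])
      (use t in auto)
  define A where "A = {s \<in> {0..t}. norm (z s) \<le> r + K * s}"
  have "A = {0..t} \<inter> (\<lambda>s. norm (z s) - K * s) -` {..r}" by (auto simp: A_def)
  moreover have "closed \<dots>"
    by (intro continuous_closed_preimage continuous_intros cont)
  ultimately have "compact A"
    by (metis (no_types, lifting) Int_lower1 bounded_closed_interval bounded_subset compact_eq_bounded_closed)
  moreover have "0 \<in> A" using assms t by (auto simp: A_def)
  ultimately obtain s where s: "s \<in> A" and last: "\<And>u. u \<in> A \<Longrightarrow> u \<le> s"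
    using compact_attains_sup by (metis empty_iff)
  then have "s < t" using above by (auto simp: A_def less_le)
  have "0 \<le> s" using s by (simp add: A_def)
  have beyond: "r + K * u < norm (z u)" if "u \<in> {s<..t}" for u
    using last[of u] that \<open>0 \<le> s\<close> by (fastforce simp: A_def)
  have derz: "(z has_derivative (\<lambda>h. h *\<^sub>R z' u)) (at u)" if "s < u" "u < t" for u
  proof -
    have "(z has_derivative (\<lambda>h. h *\<^sub>R z' u)) (at u within {0..T})"
      using der[of u] that t \<open>0 \<le> s\<close> by (auto simp: has_vector_derivative_def)
    then show ?thesis using that t \<open>0 \<le> s\<close> by (simp add: at_within_Icc_at)
  qed
  have nz: "z u \<noteq> 0" if "s < u" "u < t" for u
    using beyond[of u] that \<open>0 \<le> s\<close> \<open>0 < r\<close> mult_nonneg_nonneg[OF \<open>0 \<le> K\<close>, of u] by auto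
  have "continuous_on {s..t} (\<lambda>u. norm (z u))"
    by (intro continuous_intros continuous_on_subset[OF cont]) (use \<open>0 \<le> s\<close> in auto)
  then obtain u where u: "s < u" "u < t"
    and eq: "norm (z t) - norm (z s) = sgn (z u) \<bullet> ((t - s) *\<^sub>R z' u)"
  proof (rule mvt[OF \<open>s < t\<close>])
    fix u assume "s < u" "u < t"
    then show "((\<lambda>u. norm (z u)) has_derivative (\<lambda>h. sgn (z u) \<bullet> (h *\<^sub>R z' u))) (at u)"
      using has_derivative_compose[OF derz has_derivative_norm, OF _ _ nz]
      by (simp add: inner_commute)
  qed auto
  have "r \<le> norm (z u)"
    using beyond[of u] u \<open>0 \<le> s\<close> mult_nonneg_nonneg[OF \<open>0 \<le> K\<close>, of u] by auto
  then have "z u \<bullet> z' u \<le> K * norm (z u)" using out u t \<open>0 \<le> s\<close> by auto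
  then have "sgn (z u) \<bullet> z' u \<le> K"
    using nz[OF u] by (simp add: sgn_div_norm field_simps)
  then have "norm (z t) - norm (z s) \<le> K * (t - s)"
    using eq \<open>s < t\<close> by (simp add: mult.commute)
  then show False using s above by (auto simp: A_def algebra_simps)
qed

section \<open>Existence for globally Lipschitz fields\<close>

text \<open>Banach's fixed-point theorem for the integral equation. In the weighted norm
\<open>sup exp (- l t) |y t|\<close> with \<open>l > 2 L\<close> the integral operator is a contraction on an interval of any
length, so no solutions on short intervals have to be glued. The weight is built in by iterating on
\<open>u t = exp (- l t) y t\<close> with the plain supremum norm.\<close>

lemma lipschitz_field_solution_exists:
  fixes G :: "'a::banach \<Rightarrow> 'a"
  assumes lip: "L-lipschitz_on UNIV G" and "0 \<le> T"
  obtains y where "y 0 = y0"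
    and "\<And>t. t \<in> {0..T} \<Longrightarrow> (y has_vector_derivative G (y t)) (at t within {0..T})"
proof -
  define l where "l = 2 * (L + 1)"
  have "L \<ge> 0" using lip by (rule lipschitz_on_nonneg)
  then have "l > 0" by (simp add: l_def)
  have contG: "continuous_on S G" for S
    using lipschitz_on_continuous_on[OF lip] continuous_on_subset by blast
  define g where "g = (\<lambda>(u :: real \<Rightarrow>\<^sub>C 'a) s. G (exp (l * s) *\<^sub>R u s))"
  define P where "P = (\<lambda>(u :: real \<Rightarrow>\<^sub>C 'a) t. exp (- l * t) *\<^sub>R (y0 + integral {0..t} (g u)))"
  \<comment> \<open>Bounded continuous functions live on the whole line: extend constantly beyond \<open>{0..T}\<close>.\<close>
  define clip where "clip = (\<lambda>t. max 0 (min T t))"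
  have clip: "clip t \<in> {0..T}" for t using \<open>0 \<le> T\<close> by (auto simp: clip_def)
  have clip_id: "clip t = t" if "t \<in> {0..T}" for t using that by (auto simp: clip_def)
  have contg: "continuous_on S (g u)" for S u
    unfolding g_def
    by (rule continuous_on_compose2[OF contG[of UNIV]]) (auto intro!: continuous_intros)
  have contP: "continuous_on {0..T} (P u)" for u
    unfolding P_def
    by (intro continuous_intros indefinite_integral_continuous_1 integrable_continuous_real contg)
  have bc: "(\<lambda>t. P u (clip t)) \<in> bcontfun" for u
  proof -
    have "continuous_on UNIV (\<lambda>t. P u (clip t))"
      by (rule continuous_on_compose2[OF contP]) (use clip in \<open>auto simp: clip_def intro!: continuous_intros\<close>)
    moreover have "bounded (P u ` {0..T})"
      using compact_continuous_image[OF contP compact_Icc] by (rule compact_imp_bounded)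
    then have "bounded (range (\<lambda>t. P u (clip t)))"
      by (rule bounded_subset) (use clip in auto)
    ultimately show ?thesis by (simp add: bcontfun_def)
  qed
  define Phi where "Phi = (\<lambda>u. Bcontfun (\<lambda>t. P u (clip t)))"
  have Phi: "Phi u t = P u (clip t)" for u t
    using bc by (simp add: Phi_def Bcontfun_inverse)
  have contraction: "dist (Phi u) (Phi v) \<le> 1/2 * dist u v" for u v
  proof (rule dist_bound)
    fix t
    define \<tau> where "\<tau> = clip t"
    have "0 \<le> \<tau>" using clip by (simp add: \<tau>_def)
    have int: "g w integrable_on {0..\<tau>}" for w by (intro integrable_continuous_real contg)
    have ftc: "((\<lambda>s. L * exp (l * s) * dist u v) has_integral
        L * exp (l * \<tau>) / l * dist u v - L * exp (l * 0) / l * dist u v) {0..\<tau>}"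
      by (rule fundamental_theorem_of_calculus[OF \<open>0 \<le> \<tau>\<close>])
        (use \<open>l > 0\<close> in \<open>auto intro!: derivative_eq_intros
            simp: has_real_derivative_iff_has_vector_derivative[symmetric]\<close>)
    have "norm (integral {0..\<tau>} (\<lambda>s. g u s - g v s)) \<le> integral {0..\<tau>} (\<lambda>s. L * exp (l * s) * dist u v)"
    proof (rule integral_norm_bound_integral)
      show "(\<lambda>s. g u s - g v s) integrable_on {0..\<tau>}" by (intro integrable_diff int)
      show "(\<lambda>s. L * exp (l * s) * dist u v) integrable_on {0..\<tau>}" using ftc by blast
      fix s
      have "norm (g u s - g v s) \<le> L * dist (exp (l * s) *\<^sub>R u s) (exp (l * s) *\<^sub>R v s)"
        unfolding g_def dist_norm[symmetric] by (rule lipschitz_onD[OF lip]) auto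
      also have "\<dots> = L * exp (l * s) * dist (u s) (v s)"
        by (simp add: dist_norm scaleR_diff_right[symmetric])
      also have "\<dots> \<le> L * exp (l * s) * dist u v"
        using \<open>L \<ge> 0\<close> dist_bounded[of u s v] by (intro mult_left_mono) auto
      finally show "norm (g u s - g v s) \<le> L * exp (l * s) * dist u v" .
    qed
    also have "\<dots> = L * (exp (l * \<tau>) - 1) / l * dist u v"
      using integral_unique[OF ftc] by (simp add: algebra_simps diff_divide_distrib)
    also have "\<dots> \<le> exp (l * \<tau>) * (1/2 * dist u v)"
    proof -
      have "L * (exp (l * \<tau>) - 1) \<le> l / 2 * exp (l * \<tau>)"
        using \<open>L \<ge> 0\<close> by (simp add: l_def algebra_simps) 
      then have "L * (exp (l * \<tau>) - 1) / l \<le> exp (l * \<tau>) / 2"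
        using \<open>l > 0\<close> by (simp add: field_simps)
      from mult_right_mono[OF this zero_le_dist[of u v]] show ?thesis by simp
    qed
    finally have "exp (- l * \<tau>) * norm (integral {0..\<tau>} (\<lambda>s. g u s - g v s))
        \<le> exp (- l * \<tau>) * (exp (l * \<tau>) * (1/2 * dist u v))"
      by (intro mult_left_mono) auto
    moreover have "exp (- l * \<tau>) * (exp (l * \<tau>) * (1/2 * dist u v)) = 1/2 * dist u v"
      by (simp add: mult.assoc[symmetric] exp_add[symmetric])
    moreover have "dist (Phi u t) (Phi v t) = exp (- l * \<tau>) * norm (integral {0..\<tau>} (\<lambda>s. g u s - g v s))"
      by (simp add: Phi P_def \<tau>_def[symmetric] dist_norm scaleR_diff_right[symmetric] integral_diff[OF int int])
    ultimately show "dist (Phi u t) (Phi v t) \<le> 1/2 * dist u v" by (simp only:)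
  qed
  obtain u where u: "Phi u = u"
    using banach_fix_type[of "1/2" Phi] contraction by auto
  define y where "y = (\<lambda>t. exp (l * t) *\<^sub>R u t)"
  have y: "y t = y0 + integral {0..t} (\<lambda>s. G (y s))" if "t \<in> {0..T}" for t
  proof -
    have "u t = P u t" using Phi[of u t] u clip_id[OF that] by simp
    then show ?thesis
      by (simp add: y_def P_def g_def exp_add[symmetric])
  qed
  show thesis
  proof
    show "y 0 = y0" using y[of 0] \<open>0 \<le> T\<close> by simp
    fix t assume t: "t \<in> {0..T}"
    have "continuous_on {0..T} (\<lambda>s. G (y s))"
      using contg[of _ u] by (simp add: y_def g_def)
    then have "((\<lambda>t. y0 + integral {0..t} (\<lambda>s. G (y s))) has_vector_derivative G (y t)) (at t within {0..T})"
      using t by (auto intro!: derivative_eq_intros integral_has_vector_derivative)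
    then show "(y has_vector_derivative G (y t)) (at t within {0..T})"
      by (rule has_vector_derivative_transform[OF t, rotated]) (simp add: y)
  qed
qed

section \<open>Fields that are Lipschitz on bounded sets\<close>

text \<open>For fields on a finite-dimensional space this is the usual local Lipschitz condition. The form
with balls is closed under bounded bilinear operations, so polynomial expressions in matrices
satisfy it by their syntactic structure.\<close>

definition lipschitz_on_balls :: "('a::real_normed_vector \<Rightarrow> 'b::real_normed_vector) \<Rightarrow> bool" where
  "lipschitz_on_balls f \<longleftrightarrow> (\<forall>r. \<exists>L. L-lipschitz_on (cball 0 r) f)"

lemma lipschitz_on_ballsE:
  assumes "lipschitz_on_balls f"
  obtains L where "L-lipschitz_on (cball 0 r) f"
  using assms by (auto simp: lipschitz_on_balls_def)

lemma lipschitz_on_balls_bounded: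
  assumes "lipschitz_on_balls f"
  obtains B where "0 < B" "\<And>x. norm x \<le> r \<Longrightarrow> norm (f x) \<le> B"
proof -
  obtain L where L: "L-lipschitz_on (cball 0 r) f" using assms by (rule lipschitz_on_ballsE)
  have "norm (f x) \<le> norm (f 0) + L * \<bar>r\<bar> + 1" if x: "norm x \<le> r" for x
  proof -
    have "norm (f x - f 0) \<le> L * norm (x - 0)"
      using x order_trans[OF norm_ge_zero x] by (intro lipschitz_on_normD[OF L]) auto
    also have "\<dots> \<le> L * \<bar>r\<bar>"
      using x lipschitz_on_nonneg[OF L] by (intro mult_left_mono) auto
    finally show ?thesis using norm_triangle_sub[of "f x" "f 0"] by linarith
  qed
  moreover have "0 < norm (f 0) + L * \<bar>r\<bar> + 1"
    using lipschitz_on_nonneg[OF L] by (smt (verit) abs_ge_zero mult_nonneg_nonneg norm_ge_zero)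
  ultimately show thesis using that by blast
qed

lemma lipschitz_on_balls_const: "lipschitz_on_balls (\<lambda>x. k)"
  unfolding lipschitz_on_balls_def using lipschitz_on_constant by blast

lemma lipschitz_on_balls_ident: "lipschitz_on_balls (\<lambda>x. x)"
  unfolding lipschitz_on_balls_def using lipschitz_on_id by blast

lemma lipschitz_on_balls_add:
  assumes "lipschitz_on_balls f" "lipschitz_on_balls g"
  shows "lipschitz_on_balls (\<lambda>x. f x + g x)"
  using assms lipschitz_on_add unfolding lipschitz_on_balls_def by metis

lemma lipschitz_on_balls_diff:
  assumes "lipschitz_on_balls f" "lipschitz_on_balls g"
  shows "lipschitz_on_balls (\<lambda>x. f x - g x)"
  using assms lipschitz_on_diff unfolding lipschitz_on_balls_def by metis

lemma lipschitz_on_balls_bilinear: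
  fixes f :: "'a::real_normed_vector \<Rightarrow> 'b::real_normed_vector"
    and g :: "'a \<Rightarrow> 'c::real_normed_vector"
    and h :: "'b \<Rightarrow> 'c \<Rightarrow> 'd::real_normed_vector"
  assumes "bounded_bilinear h" and f: "lipschitz_on_balls f" and g: "lipschitz_on_balls g"
  shows "lipschitz_on_balls (\<lambda>x. h (f x) (g x))"
  unfolding lipschitz_on_balls_def
proof
  fix r :: real
  interpret bounded_bilinear h by fact
  obtain K where "K > 0" and K: "\<And>u v. norm (h u v) \<le> norm u * norm v * K"
    using pos_bounded by blast
  obtain A where "A > 0" and A: "\<And>x. norm x \<le> r \<Longrightarrow> norm (f x) \<le> A"
    using lipschitz_on_balls_bounded[OF f] by metis
  obtain B where "B > 0" and B: "\<And>x. norm x \<le> r \<Longrightarrow> norm (g x) \<le> B"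
    using lipschitz_on_balls_bounded[OF g] by metis
  obtain L where L: "L-lipschitz_on (cball 0 r) f" using f by (rule lipschitz_on_ballsE)
  obtain M where M: "M-lipschitz_on (cball 0 r) g" using g by (rule lipschitz_on_ballsE)
  note nonneg = lipschitz_on_nonneg[OF L] lipschitz_on_nonneg[OF M]
  have "(L * B * K + A * M * K)-lipschitz_on (cball 0 r) (\<lambda>x. h (f x) (g x))"
  proof (rule lipschitz_onI)
    fix x y :: 'a assume xy: "x \<in> cball 0 r" "y \<in> cball 0 r"
    have "h (f x) (g x) - h (f y) (g y) = h (f x - f y) (g x) + h (f y) (g x - g y)"
      by (simp add: diff_left diff_right)
    then have "norm (h (f x) (g x) - h (f y) (g y))
        \<le> norm (f x - f y) * norm (g x) * K + norm (f y) * norm (g x - g y) * K"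
      using norm_triangle_mono[OF K K] by simp
    also have "\<dots> \<le> (L * norm (x - y)) * B * K + A * (M * norm (x - y)) * K"
      using xy nonneg \<open>K > 0\<close> \<open>A > 0\<close> \<open>B > 0\<close>
      by (intro add_mono mult_mono lipschitz_on_normD[OF L] lipschitz_on_normD[OF M] A B) auto
    finally show "dist (h (f x) (g x)) (h (f y) (g y)) \<le> (L * B * K + A * M * K) * dist x y"
      by (simp add: dist_norm algebra_simps)
  qed (use nonneg \<open>K > 0\<close> \<open>A > 0\<close> \<open>B > 0\<close> in auto)
  then show "\<exists>L. L-lipschitz_on (cball 0 r) (\<lambda>x. h (f x) (g x))" ..
qed

text \<open>A linear map is the bilinear map \<open>(c, u) \<mapsto> c h(u)\<close> with \<open>c = 1\<close>.\<close>

lemma lipschitz_on_balls_linear: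
  assumes "bounded_linear h" and f: "lipschitz_on_balls f"
  shows "lipschitz_on_balls (\<lambda>x. h (f x))"
proof -
  have "bounded_bilinear (\<lambda>(c::real) u. c *\<^sub>R h u)"
    using bounded_bilinear.comp[OF bounded_bilinear_scaleR bounded_linear_ident assms(1)] .
  from lipschitz_on_balls_bilinear[OF this lipschitz_on_balls_const[of 1] f] show ?thesis by simp
qed

text \<open>On the subspace itself, the metric projection onto its ball is the radial one: by the triangle
inequality no point of norm at most \<open>r\<close> is closer to \<open>x\<close> than \<open>|x| - r\<close>.\<close>

lemma closest_point_subspace_cball:
  fixes x :: "'a::euclidean_space"
  assumes S: "subspace S" "x \<in> S" and "0 \<le> r" "r \<le> norm x" "x \<noteq> 0"
  shows "closest_point (S \<inter> cball 0 r) x = (r / norm x) *\<^sub>R x"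
proof (rule closest_point_unique[symmetric])
  show "convex (S \<inter> cball 0 r)" "closed (S \<inter> cball 0 r)"
    using S by (auto intro: convex_Int subspace_imp_convex closed_Int closed_subspace)
  show "(r / norm x) *\<^sub>R x \<in> S \<inter> cball 0 r" using assms by (simp add: subspace_scale)
  have "x - (r / norm x) *\<^sub>R x = ((norm x - r) / norm x) *\<^sub>R x"
    using assms by (simp add: diff_divide_distrib scaleR_left_diff_distrib)
  then have "dist x ((r / norm x) *\<^sub>R x) = norm x - r"
    using assms by (simp add: dist_norm)
  moreover have "norm x - r \<le> dist x z" if "z \<in> S \<inter> cball 0 r" for z
    using norm_triangle_ineq2[of x z] that by (simp add: dist_norm)
  ultimately show "\<forall>z\<in>S \<inter> cball 0 r. dist x ((r / norm x) *\<^sub>R x) \<le> dist x z" by simp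
qed

lemma lipschitz_truncation:
  fixes F :: "'a::euclidean_space \<Rightarrow> 'b::real_normed_vector"
  assumes "lipschitz_on_balls F" and C: "convex C" "closed C" "C \<noteq> {}" "C \<subseteq> cball 0 r"
  obtains L where "L-lipschitz_on UNIV (\<lambda>x. F (closest_point C x))"
proof -
  have "1-lipschitz_on UNIV (closest_point C)"
    by (rule lipschitz_onI) (use closest_point_lipschitz[OF C(1-3)] in auto)
  moreover obtain L where "L-lipschitz_on (cball 0 r) F"
    using assms by (blast elim: lipschitz_on_ballsE)
  then have "L-lipschitz_on (closest_point C ` UNIV) F"
    by (rule lipschitz_on_subset) (use closest_point_in_set[OF C(2,3)] C(4) in blast)
  ultimately show thesis using lipschitz_on_compose2 that by blast
qed

text \<open>The components of \<open>y\<close> along the orthogonal complement of \<open>S\<close> have zero derivative.\<close>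

lemma stays_in_subspace:
  fixes y :: "real \<Rightarrow> 'a::euclidean_space"
  assumes S: "subspace S" and "y 0 \<in> S" and T: "t \<in> {0..T}"
    and der: "\<And>s. s \<in> {0..T} \<Longrightarrow> (y has_vector_derivative y' s) (at s within {0..T})"
    and y': "\<And>s. s \<in> {0..T} \<Longrightarrow> y' s \<in> S"
  shows "y t \<in> S"
proof -
  have "orthogonal v (y t)" if v: "v \<in> orthogonal_comp S" for v
  proof -
    have "((\<lambda>s. v \<bullet> y s) has_vector_derivative 0) (at s within {0..T})" if s: "s \<in> {0..T}" for s
      using bounded_linear.has_vector_derivative[OF bounded_linear_inner_right der[OF s], of v]
        v y'[OF s] by (auto simp: orthogonal_comp_def orthogonal_def inner_commute)
    then obtain k where "\<And>s. s \<in> {0..T} \<Longrightarrow> v \<bullet> y s = k"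
      using has_vector_derivative_zero_constant[of "{0..T}"] by blast
    then have "v \<bullet> y t = v \<bullet> y 0" using T by auto
    then show ?thesis
      using v \<open>y 0 \<in> S\<close> by (auto simp: orthogonal_comp_def orthogonal_def inner_commute)
  qed
  then have "y t \<in> orthogonal_comp (orthogonal_comp S)"
    by (auto simp: orthogonal_comp_def)
  then show ?thesis using orthogonal_comp_self[OF S] by simp
qed

section \<open>Solutions in the space of symmetric traceless matrices\<close>

lemma S0_iff:
  "Q \<in> S0 \<longleftrightarrow> Q$2$1 = Q$1$2 \<and> Q$3$1 = Q$1$3 \<and> Q$3$2 = Q$2$3 \<and> Q$3$3 = - Q$1$1 - Q$2$2"
  by (auto simp: S0_def vec_eq_iff forall_3 transpose_def trace_def sum_3)

lemma subspace_S0: "subspace S0"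
  by (auto simp: subspace_def S0_def trace_def sum.distrib sum_distrib_left[symmetric]
      vec_eq_iff transpose_def)

lemma solution_on_subinterval:
  assumes "solution_on F Q0 T Q" "S \<le> T"
  shows "solution_on F Q0 S Q"
  using assms unfolding solution_on_def
  by (auto intro!: has_vector_derivative_within_subset[of Q _ _ "{0..T}" "{0..S}"])

lemma solution_on_bounded:
  assumes "solution_on F Q0 T Q"
  obtains B where "\<And>t. t \<in> {0..T} \<Longrightarrow> norm (Q t) \<le> B"
proof -
  have "continuous_on {0..T} Q"
    using assms unfolding solution_on_def by (intro continuous_on_vector_derivative) blast
  then have "bounded (Q ` {0..T})"
    by (intro compact_imp_bounded compact_continuous_image) auto
  then obtain B where "\<forall>t\<in>{0..T}. norm (Q t) \<le> B" by (auto simp: bounded_iff)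
  then show thesis using that by blast
qed

text \<open>Each of the two solutions is bounded by compactness of the time interval, so a Lipschitz constant
for a ball containing both turns their difference into a Gronwall situation with \<open>e = 0\<close>.\<close>

lemma solution_on_unique:
  assumes F: "lipschitz_on_balls F"
    and Q: "solution_on F Q0 T Q" and R: "solution_on F Q0 T R" and t: "t \<in> {0..T}"
  shows "Q t = R t"
proof -
  obtain A where A: "\<And>t. t \<in> {0..T} \<Longrightarrow> norm (Q t) \<le> A" using solution_on_bounded[OF Q] by metis
  obtain B where B: "\<And>t. t \<in> {0..T} \<Longrightarrow> norm (R t) \<le> B" using solution_on_bounded[OF R] by metis
  obtain L where L: "L-lipschitz_on (cball 0 (max A B)) F" using F by (rule lipschitz_on_ballsE)
  have "(norm (Q t - R t))\<^sup>2 \<le> exp ((2 * L + 1) * t) * (0\<^sup>2 * t)"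
  proof (rule gronwall_norm[of T "\<lambda>s. Q s - R s" "\<lambda>s. F (Q s) - F (R s)"])
    fix s assume s: "s \<in> {0..T}"
    show "((\<lambda>s. Q s - R s) has_vector_derivative F (Q s) - F (R s)) (at s within {0..T})"
      using Q R s by (auto simp: solution_on_def intro!: has_vector_derivative_diff)
    show "norm (F (Q s) - F (R s)) \<le> L * norm (Q s - R s) + 0"
      using lipschitz_on_normD[OF L, of "Q s" "R s"] A[OF s] B[OF s] by auto
  qed (use t Q R lipschitz_on_nonneg[OF L] in \<open>auto simp: solution_on_def\<close>)
  then show ?thesis by simp
qed

text \<open>The field is replaced by its composition with the metric projection \<open>p\<close> onto the part of \<open>S0\<close>
in the ball of radius \<open>r + 1\<close>. Since \<open>p\<close> takes values in \<open>S0\<close> everywhere, the truncated field does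
so too and its solution remains in \<open>S0\<close>. There \<open>p\<close> is radial, so the bound on \<open>Q \<bullet> F Q\<close> in the shell
\<open>r \<le> |Q| \<le> r + 1\<close> extends to the truncated field at all points beyond the shell, and the barrier
keeps the solution where the truncation is the identity.\<close>

lemma confined_solution_exists:
  assumes F: "lipschitz_on_balls F" and FS: "\<And>Q. Q \<in> S0 \<Longrightarrow> F Q \<in> S0"
    and out: "\<And>Q. Q \<in> S0 \<Longrightarrow> r \<le> norm Q \<Longrightarrow> norm Q \<le> r + 1 \<Longrightarrow> Q \<bullet> F Q \<le> K * norm Q"
    and "0 < r" "0 \<le> K" "K * T \<le> 1" "0 \<le> T" and Q0: "Q0 \<in> S0" "norm Q0 \<le> r"
  obtains Q where "solution_on F Q0 T Q" "\<And>t. t \<in> {0..T} \<Longrightarrow> norm (Q t) \<le> r + 1"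
proof -
  define C where "C = S0 \<inter> cball 0 (r + 1)"
  have C: "convex C" "closed C" "C \<noteq> {}"
    unfolding C_def using Q0 subspace_imp_convex[OF subspace_S0] closed_subspace[OF subspace_S0]
    by (auto intro!: convex_Int closed_Int)
  define p where "p = closest_point C"
  have p_in: "p Q = Q" if "Q \<in> S0" "norm Q \<le> r + 1" for Q
    using that by (simp add: p_def C_def closest_point_self)
  have p_out: "p Q = ((r + 1) / norm Q) *\<^sub>R Q" if "Q \<in> S0" "r + 1 \<le> norm Q" for Q
    unfolding p_def C_def using that \<open>0 < r\<close>
    by (intro closest_point_subspace_cball subspace_S0) auto
  have p_S0: "p Q \<in> S0" for Q
    using closest_point_in_set[OF C(2,3)] by (auto simp: p_def C_def)
  obtain L where "L-lipschitz_on UNIV (\<lambda>Q. F (p Q))"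
    unfolding p_def using lipschitz_truncation[OF F C] by (metis C_def Int_lower2)
  then obtain Q where init: "Q 0 = Q0"
    and der: "\<And>t. t \<in> {0..T} \<Longrightarrow> (Q has_vector_derivative F (p (Q t))) (at t within {0..T})"
    using lipschitz_field_solution_exists \<open>0 \<le> T\<close> by blast
  have S0: "Q t \<in> S0" if "t \<in> {0..T}" for t
    by (rule stays_in_subspace[OF subspace_S0 _ that der]) (simp_all add: init Q0 FS p_S0)
  have bound: "norm (Q t) \<le> r + 1" if t: "t \<in> {0..T}" for t
  proof -
    have "norm (Q t) \<le> r + K * t"
    proof (rule norm_barrier[OF der])
      fix s assume s: "s \<in> {0..T}" and far: "r \<le> norm (Q s)"
      show "Q s \<bullet> F (p (Q s)) \<le> K * norm (Q s)"
      proof (cases "norm (Q s) \<le> r + 1")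
        case True
        then show ?thesis using out[OF S0[OF s] far] p_in S0[OF s] by simp
      next
        case False
        \<comment> \<open>The bound at the boundary point \<open>p (Q s)\<close> is homogeneous in the radial factor \<open>k\<close>.\<close>
        define k where "k = (r + 1) / norm (Q s)"
        have "0 < norm (Q s)" using False \<open>0 < r\<close> by linarith
        then have k: "0 < k" "p (Q s) = k *\<^sub>R Q s" and nk: "norm (p (Q s)) = r + 1"
          using False \<open>0 < r\<close> p_out S0[OF s] by (auto simp: k_def)
        have "p (Q s) \<bullet> F (p (Q s)) \<le> K * norm (p (Q s))"
          using nk \<open>0 < r\<close> by (intro out p_S0) auto
        then have "k * (Q s \<bullet> F (p (Q s))) \<le> k * (K * norm (Q s))"
          using k by (simp add: mult.left_commute)
        then show ?thesis using \<open>0 < k\<close> by simp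
      qed
    qed (use init Q0 \<open>0 < r\<close> \<open>0 \<le> K\<close> t in auto)
    moreover have "K * t \<le> K * T" using t \<open>0 \<le> K\<close> by (intro mult_left_mono) auto
    ultimately show ?thesis using \<open>K * T \<le> 1\<close> by linarith
  qed
  show thesis
  proof (rule that)
    show "solution_on F Q0 T Q"
      using init der S0 bound p_in by (simp add: solution_on_def)
  qed (rule bound)
qed

lemma confined_flow:
  assumes F: "lipschitz_on_balls F" and "\<And>Q. Q \<in> S0 \<Longrightarrow> F Q \<in> S0"
    and "\<And>Q. Q \<in> S0 \<Longrightarrow> r \<le> norm Q \<Longrightarrow> norm Q \<le> r + 1 \<Longrightarrow> Q \<bullet> F Q \<le> K * norm Q"
    and "0 < r" "0 \<le> K" "K * T \<le> 1" "0 \<le> T" "Q0 \<in> S0" "norm Q0 \<le> r"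
  shows "the_solution_exists_on F Q0 T"
    and "\<And>Q t. solution_on F Q0 T Q \<Longrightarrow> t \<in> {0..T} \<Longrightarrow> norm (Q t) \<le> r + 1"
proof -
  obtain Q where Q: "solution_on F Q0 T Q" and bound: "\<And>t. t \<in> {0..T} \<Longrightarrow> norm (Q t) \<le> r + 1"
    using confined_solution_exists[OF assms] by blast
  show "the_solution_exists_on F Q0 T"
    unfolding the_solution_exists_on_def
    using Q solution_on_subinterval[OF Q] solution_on_unique[OF F] by (metis atLeastAtMost_iff)
  show "norm (Q' t) \<le> r + 1" if "solution_on F Q0 T Q'" "t \<in> {0..T}" for Q' t
    using solution_on_unique[OF F that(1) Q that(2)] bound[OF that(2)] by simp
qed

text \<open>The uniform bound \<open>B\<close> is essential: it yields one Lipschitz constant for \<open>F\<close> and one bound for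
\<open>H\<close> that serve all \<open>\<xi>\<close>, so that the Gronwall estimate is linear in \<open>1/\<xi>\<close>.\<close>

lemma perturbed_solutions_converge:
  assumes F: "lipschitz_on_balls F" and H: "lipschitz_on_balls H" and "0 \<le> T"
    and Q: "\<And>\<xi>. \<xi> > 0 \<Longrightarrow> solution_on (\<lambda>Q. F Q + (1/\<xi>) *\<^sub>R H Q) Q0 T (Q \<xi>)"
    and R: "solution_on F Q0 T R"
    and boundQ: "\<And>\<xi> t. \<xi> > 0 \<Longrightarrow> t \<in> {0..T} \<Longrightarrow> norm (Q \<xi> t) \<le> B"
  shows "((\<lambda>\<xi>. SUP t\<in>{0..T}. norm (Q \<xi> t - R t)) \<longlongrightarrow> 0) at_top"
proof -
  obtain A where A: "\<And>t. t \<in> {0..T} \<Longrightarrow> norm (R t) \<le> A" using solution_on_bounded[OF R] by metis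
  obtain L where L: "L-lipschitz_on (cball 0 (max A B)) F" using F by (rule lipschitz_on_ballsE)
  note L0 = lipschitz_on_nonneg[OF L]
  obtain C where "C > 0" and C: "\<And>Q. norm Q \<le> B \<Longrightarrow> norm (H Q) \<le> C"
    using lipschitz_on_balls_bounded[OF H] by metis
  define k where "k = sqrt (exp ((2 * L + 1) * T) * T)"
  have est: "norm (Q \<xi> t - R t) \<le> k * (C / \<xi>)" if "\<xi> > 0" and t: "t \<in> {0..T}" for \<xi> t
  proof -
    have "(norm (Q \<xi> t - R t))\<^sup>2 \<le> exp ((2 * L + 1) * t) * ((C / \<xi>)\<^sup>2 * t)"
    proof (rule gronwall_norm[of T "\<lambda>s. Q \<xi> s - R s"
          "\<lambda>s. F (Q \<xi> s) + (1/\<xi>) *\<^sub>R H (Q \<xi> s) - F (R s)"])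
      fix s assume s: "s \<in> {0..T}"
      show "((\<lambda>s. Q \<xi> s - R s) has_vector_derivative F (Q \<xi> s) + (1/\<xi>) *\<^sub>R H (Q \<xi> s) - F (R s))
          (at s within {0..T})"
        using Q[OF \<open>\<xi> > 0\<close>] R s by (auto simp: solution_on_def intro!: has_vector_derivative_diff)
      have "norm (F (Q \<xi> s) - F (R s)) \<le> L * norm (Q \<xi> s - R s)"
        using lipschitz_on_normD[OF L, of "Q \<xi> s" "R s"] A[OF s] boundQ[OF \<open>\<xi> > 0\<close> s] by auto
      moreover have "norm ((1/\<xi>) *\<^sub>R H (Q \<xi> s)) \<le> C / \<xi>"
        using C[OF boundQ[OF \<open>\<xi> > 0\<close> s]] \<open>\<xi> > 0\<close> by (simp add: divide_right_mono)
      moreover have "F (Q \<xi> s) + (1/\<xi>) *\<^sub>R H (Q \<xi> s) - F (R s)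
          = (F (Q \<xi> s) - F (R s)) + (1/\<xi>) *\<^sub>R H (Q \<xi> s)" by simp
      ultimately show "norm (F (Q \<xi> s) + (1/\<xi>) *\<^sub>R H (Q \<xi> s) - F (R s))
          \<le> L * norm (Q \<xi> s - R s) + C / \<xi>"
        by (metis norm_triangle_mono)
    qed (use t Q[OF \<open>\<xi> > 0\<close>] R L0 in \<open>auto simp: solution_on_def\<close>)
    also have "\<dots> \<le> exp ((2 * L + 1) * T) * ((C / \<xi>)\<^sup>2 * T)"
      using t L0 by (intro mult_mono) (auto intro!: mult_left_mono)
    also have "exp ((2 * L + 1) * T) * ((C / \<xi>)\<^sup>2 * T) = (exp ((2 * L + 1) * T) * T) * (C / \<xi>)\<^sup>2"
      by (simp only: mult_ac)
    also have "exp ((2 * L + 1) * T) * T = k\<^sup>2" using \<open>0 \<le> T\<close> by (simp add: k_def)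
    also have "k\<^sup>2 * (C / \<xi>)\<^sup>2 = (k * (C / \<xi>))\<^sup>2" by (rule power_mult_distrib[symmetric])
    finally show ?thesis
      by (rule power2_le_imp_le) (use \<open>0 \<le> T\<close> \<open>C > 0\<close> \<open>\<xi> > 0\<close> in \<open>simp add: k_def\<close>)
  qed
  have "((\<lambda>\<xi>. k * (C / \<xi>)) \<longlongrightarrow> k * 0) at_top"
    by (intro tendsto_mult tendsto_const real_tendsto_divide_at_top[OF tendsto_const] filterlim_ident)
  then have lim: "((\<lambda>\<xi>. k * (C / \<xi>)) \<longlongrightarrow> 0) at_top" by simp
  show ?thesis
  proof (rule tendsto_sandwich[where f = "\<lambda>_. 0" and h = "\<lambda>\<xi>. k * (C / \<xi>)"])
    have "0 \<le> (SUP t\<in>{0..T}. norm (Q \<xi> t - R t))" if "\<xi> > 0" for \<xi>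
      using est[OF that] \<open>0 \<le> T\<close> by (intro cSUP_upper2[where x = 0]) (auto intro!: bdd_aboveI2[where M = "k * (C / \<xi>)"])
    then show "\<forall>\<^sub>F \<xi> in at_top. 0 \<le> (SUP t\<in>{0..T}. norm (Q \<xi> t - R t))"
      by (rule eventually_mono[OF eventually_gt_at_top])
    have "(SUP t\<in>{0..T}. norm (Q \<xi> t - R t)) \<le> k * (C / \<xi>)" if "\<xi> > 0" for \<xi>
      using est[OF that] \<open>0 \<le> T\<close> by (intro cSUP_least) auto
    then show "\<forall>\<^sub>F \<xi> in at_top. (SUP t\<in>{0..T}. norm (Q \<xi> t - R t)) \<le> k * (C / \<xi>)"
      by (rule eventually_mono[OF eventually_gt_at_top])
  qed (use lim in auto)
qed

section \<open>The two tensor fields\<close>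

definition relaxation_field :: "real \<Rightarrow> real \<Rightarrow> real \<Rightarrow> real^3^3 \<Rightarrow> real^3^3" where
  "relaxation_field a b c Q = commutator Wmat Q - a *\<^sub>R Q
     + b *\<^sub>R (Q ** Q - ((1/3) * (norm Q)\<^sup>2) *\<^sub>R mat 1) - (c * (norm Q)\<^sup>2) *\<^sub>R Q"

lemma full_field_eq:
  "full_field a b c \<xi> = (\<lambda>Q. limit_field Q + (1/\<xi>) *\<^sub>R relaxation_field a b c Q)"
  by (simp add: fun_eq_iff full_field_def relaxation_field_def)

lemma bounded_bilinear_matrix_mult:
  "bounded_bilinear ((**) :: real^'n^'m \<Rightarrow> real^'p^'n \<Rightarrow> real^'p^'m)"
  unfolding bilinear_conv_bounded_bilinear[symmetric] bilinear_def
  by (auto intro!: linearI simp: matrix_matrix_mult_def vec_eq_iff sum.distrib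
      sum_distrib_left algebra_simps)

lemma bounded_linear_trace: "bounded_linear (trace :: real^'n^'n \<Rightarrow> real)"
  unfolding linear_conv_bounded_linear[symmetric]
  by (rule linearI) (simp_all add: trace_add, simp add: trace_def sum_distrib_left)

lemmas lipschitz_on_balls_intros =
  lipschitz_on_balls_const lipschitz_on_balls_ident lipschitz_on_balls_add lipschitz_on_balls_diff
  lipschitz_on_balls_bilinear[OF bounded_bilinear_matrix_mult]
  lipschitz_on_balls_bilinear[OF bounded_bilinear_scaleR]
  lipschitz_on_balls_bilinear[OF bounded_bilinear_mult]
  lipschitz_on_balls_bilinear[OF bounded_bilinear_inner]
  lipschitz_on_balls_linear[OF bounded_linear_trace]

lemma lipschitz_limit_field: "lipschitz_on_balls limit_field"
  unfolding limit_field_def[abs_def] by (intro lipschitz_on_balls_intros)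

lemma lipschitz_relaxation_field: "lipschitz_on_balls (relaxation_field a b c)"
  unfolding relaxation_field_def[abs_def] commutator_def power2_norm_eq_inner
  by (intro lipschitz_on_balls_intros)

lemmas entries = vec_eq_iff forall_3 transpose_def trace_def sum_3 matrix_matrix_mult_def mat_def
  vector_3

lemma limit_field_S0:
  assumes "Q \<in> S0" shows "limit_field Q \<in> S0"
proof -
  note Q = assms[unfolded S0_iff]
  have Q33: "Q$3$3 = - Q$1$1 - Q$2$2" using Q by blast
  show ?thesis
    using Q by (simp add: S0_iff limit_field_def Dmat_def entries) (simp add: Q33 algebra_simps)
qed

lemma relaxation_field_S0:
  assumes "Q \<in> S0" shows "relaxation_field a b c Q \<in> S0"
proof -
  have sym: "transpose Q = Q" using assms by (simp add: S0_def)
  have Q: "Q$2$1 = Q$1$2" "Q$3$1 = Q$1$3" "Q$3$2 = Q$2$3" "Q$3$3 = - Q$1$1 - Q$2$2"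
    using assms unfolding S0_iff by blast+
  have "commutator Wmat Q \<in> S0"
    by (simp add: S0_iff commutator_def Wmat_def entries Q)
  moreover have "Q ** Q - ((1/3) * (norm Q)\<^sup>2) *\<^sub>R mat 1 \<in> S0"
    by (simp add: norm_symmetric_eq_trace[OF sym] S0_def trace_sub entries)
      (simp add: Q field_simps)
  ultimately show ?thesis
    unfolding relaxation_field_def
    using assms subspace_diff[OF subspace_S0] subspace_add[OF subspace_S0] subspace_scale[OF subspace_S0]
    by presburger
qed

lemma inner_symmetric:
  fixes Q :: "real^'n^'n"
  assumes "transpose Q = Q"
  shows "Q \<bullet> A = trace (Q ** A)"
proof -
  have "Q \<bullet> A = trace (transpose Q ** A)"
    unfolding inner_vec_def trace_def matrix_matrix_mult_def transpose_def
    by (simp, rule sum.swap)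
  then show ?thesis using assms by simp
qed

text \<open>Invariance of the trace under cyclic permutation. Geometrically, for antisymmetric \<open>A\<close> the
commutator generates rotations, which preserve the norm.\<close>

lemma inner_commutator_symmetric:
  assumes "transpose Q = Q"
  shows "Q \<bullet> commutator A Q = 0"
proof -
  have "trace (Q ** (A ** Q)) = trace (Q ** (Q ** A))"
    using trace_mul_sym[of "Q ** A" Q] by (simp only: matrix_mul_assoc)
  then show ?thesis
    by (simp only: inner_symmetric[OF assms] commutator_def trace_sub diff_self
        bounded_bilinear.diff_right[OF bounded_bilinear_matrix_mult])
qed

text \<open>The quartic term \<open>- c |Q|\<^sup>4\<close> dominates for large \<open>|Q|\<close>: the cubic term \<open>b tr(Q\<^sup>3)\<close> is at most
\<open>b K |Q|\<^sup>3\<close>, where \<open>K\<close> bounds the matrix product, and the projection of \<open>Q\<^sup>2\<close> to trace zero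
disappears because the identity is orthogonal to traceless matrices.\<close>

lemma relaxation_dissipative:
  assumes "b > 0" "c > 0"
  obtains M where "M > 0" "\<And>Q. Q \<in> S0 \<Longrightarrow> M \<le> norm Q \<Longrightarrow> Q \<bullet> relaxation_field a b c Q \<le> 0"
proof -
  obtain K where "K > 0" and K: "\<And>(P :: real^3^3) (Q :: real^3^3). norm (P ** Q) \<le> norm P * norm Q * K"
    using bounded_bilinear.pos_bounded[OF bounded_bilinear_matrix_mult] by blast
  \<comment> \<open>Chosen so that \<open>n \<ge> M\<close> gives \<open>c n \<ge> |a| + b K\<close>; the summand 1 ensures \<open>n \<ge> 1\<close>, hence
     \<open>|a| \<le> |a| n\<close>.\<close>
  define M where "M = 1 + (\<bar>a\<bar> + b * K) / c"
  have "M \<ge> 1" using assms \<open>K > 0\<close> by (simp add: M_def)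
  have "Q \<bullet> relaxation_field a b c Q \<le> 0" if Q: "Q \<in> S0" and far: "M \<le> norm Q" for Q
  proof -
    define n where "n = norm Q"
    have n: "1 \<le> n" "M \<le> n" using far \<open>M \<ge> 1\<close> by (auto simp: n_def)
    have sym: "transpose Q = Q" and tr: "trace Q = 0" using Q by (auto simp: S0_def)
    have "Q \<bullet> mat 1 = 0" by (simp add: inner_symmetric[OF sym] tr)
    then have "Q \<bullet> relaxation_field a b c Q = - a * n\<^sup>2 + b * (Q \<bullet> (Q ** Q)) - c * n\<^sup>2 * n\<^sup>2"
      by (simp add: relaxation_field_def inner_add_right inner_diff_right n_def
          inner_commutator_symmetric[OF sym] power2_norm_eq_inner)
    also have "b * (Q \<bullet> (Q ** Q)) \<le> b * (n * (n * n * K))"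
      using norm_cauchy_schwarz[of Q "Q ** Q"] mult_left_mono[OF K[of Q Q], of n] \<open>b > 0\<close>
      by (intro mult_left_mono) (auto simp: n_def)
    also have "- a * n\<^sup>2 + b * (n * (n * n * K)) - c * n\<^sup>2 * n\<^sup>2 = n\<^sup>2 * (- a + b * K * n - c * n * n)"
      by (simp add: power2_eq_square algebra_simps)
    also have "\<dots> \<le> 0"
    proof (rule mult_nonneg_nonpos)
      have "c * M \<le> c * n" using n \<open>c > 0\<close> by simp
      moreover have "c * M = c + (\<bar>a\<bar> + b * K)" using \<open>c > 0\<close> by (simp add: M_def field_simps)
      ultimately have "\<bar>a\<bar> + b * K \<le> c * n" using \<open>c > 0\<close> by linarith
      then have "(\<bar>a\<bar> + b * K) * n \<le> c * n * n" using n by (intro mult_right_mono) auto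
      moreover have "\<bar>a\<bar> * 1 \<le> \<bar>a\<bar> * n" using n by (intro mult_left_mono) auto
      ultimately show "- a + b * K * n - c * n * n \<le> 0" by (simp add: algebra_simps)
    qed simp
    finally show ?thesis by simp
  qed
  then show thesis using that \<open>M \<ge> 1\<close> by (meson less_le_trans zero_less_one)
qed

theorem proposition3p1:
  fixes a b c :: real
  assumes "b > 0" and "c > 0" and "b\<^sup>2 - 24 * a * c > 0"
  shows "\<exists>Tstar :: real \<Rightarrow> real. \<forall>Q0\<in>S0.
    Tstar (norm Q0) > 0 \<and>
    (\<forall>\<xi>>0. the_solution_exists_on (full_field a b c \<xi>) Q0 (Tstar (norm Q0))) \<and>
    the_solution_exists_on limit_field Q0 (Tstar (norm Q0)) \<and>
    (\<forall>Q R. (\<forall>\<xi>>0. solution_on (full_field a b c \<xi>) Q0 (Tstar (norm Q0)) (Q \<xi>)) \<and>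
            solution_on limit_field Q0 (Tstar (norm Q0)) R \<longrightarrow>
       ((\<lambda>\<xi>. SUP t\<in>{0..Tstar (norm Q0)}. norm (Q \<xi> t - R t)) \<longlongrightarrow> 0) at_top)"
proof -
  obtain M where "M > 0"
    and M: "\<And>Q. Q \<in> S0 \<Longrightarrow> M \<le> norm Q \<Longrightarrow> Q \<bullet> relaxation_field a b c Q \<le> 0"
    using relaxation_dissipative[OF assms(1,2)] by blast
  define r where "r = (\<lambda>n. max n M)"
  have "\<exists>K>0. \<forall>Q. norm Q \<le> r n + 1 \<longrightarrow> norm (limit_field Q) \<le> K" for n
    using lipschitz_on_balls_bounded[OF lipschitz_limit_field] by metis
  then obtain K where K0: "\<And>n. K n > 0"
    and K: "\<And>n Q. norm Q \<le> r n + 1 \<Longrightarrow> norm (limit_field Q) \<le> K n" by metis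
  define Tstar where "Tstar = (\<lambda>n. 1 / K n)"
  show ?thesis
  proof (intro exI ballI)
    fix Q0 :: "real^3^3" assume Q0: "Q0 \<in> S0"
    define n where "n = norm Q0"
    have rn: "0 < r n" "norm Q0 \<le> r n" "M \<le> r n" using \<open>M > 0\<close> by (auto simp: r_def n_def)
    have T: "0 < Tstar n" "K n * Tstar n \<le> 1" using K0[of n] by (auto simp: Tstar_def)
    have limit: "Q \<bullet> limit_field Q \<le> K n * norm Q" if "norm Q \<le> r n + 1" for Q
    proof -
      have "Q \<bullet> limit_field Q \<le> norm Q * norm (limit_field Q)" by (rule norm_cauchy_schwarz)
      also have "\<dots> \<le> norm Q * K n" using K[OF that] by (intro mult_left_mono) auto
      finally show ?thesis by (simp add: mult.commute)
    qed
    have full: "Q \<bullet> full_field a b c \<xi> Q \<le> K n * norm Q"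
      if "\<xi> > 0" and "Q \<in> S0" "r n \<le> norm Q" "norm Q \<le> r n + 1" for \<xi> Q
    proof -
      have "(1/\<xi>) * (Q \<bullet> relaxation_field a b c Q) \<le> 0"
        using M[of Q] that rn by (intro mult_nonneg_nonpos) auto
      then show ?thesis using limit[OF that(4)] by (simp add: full_field_eq inner_add_right)
    qed
    have lip: "lipschitz_on_balls (full_field a b c \<xi>)" for \<xi>
      unfolding full_field_eq
      by (intro lipschitz_on_balls_intros lipschitz_limit_field lipschitz_relaxation_field)
    have inv: "full_field a b c \<xi> Q \<in> S0" if "Q \<in> S0" for \<xi> Q
      unfolding full_field_eq
      using that limit_field_S0 relaxation_field_S0 subspace_add subspace_scale subspace_S0 by metis
    have full_flow: "the_solution_exists_on (full_field a b c \<xi>) Q0 (Tstar n)"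
      "\<And>Q t. solution_on (full_field a b c \<xi>) Q0 (Tstar n) Q \<Longrightarrow> t \<in> {0..Tstar n} \<Longrightarrow> norm (Q t) \<le> r n + 1"
      if "\<xi> > 0" for \<xi>
      using confined_flow[OF lip inv full[OF that] rn(1) less_imp_le[OF K0] T(2)
          less_imp_le[OF T(1)] Q0 rn(2)] by auto
    have conv: "((\<lambda>\<xi>. SUP t\<in>{0..Tstar n}. norm (Q \<xi> t - R t)) \<longlongrightarrow> 0) at_top"
      if "\<forall>\<xi>>0. solution_on (full_field a b c \<xi>) Q0 (Tstar n) (Q \<xi>)"
        and "solution_on limit_field Q0 (Tstar n) R" for Q R
    proof (rule perturbed_solutions_converge[OF lipschitz_limit_field lipschitz_relaxation_field])
      show "norm (Q \<xi> t) \<le> r n + 1" if "\<xi> > 0" "t \<in> {0..Tstar n}" for \<xi> t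
        using full_flow(2)[OF that(1)] \<open>\<forall>\<xi>>0. _\<close> that by blast
    qed (use that T in \<open>auto simp: full_field_eq\<close>)
    have "the_solution_exists_on limit_field Q0 (Tstar n)"
      by (rule confined_flow(1)[OF lipschitz_limit_field limit_field_S0 limit rn(1)
            less_imp_le[OF K0] T(2) less_imp_le[OF T(1)] Q0 rn(2)])
    then show "Tstar (norm Q0) > 0 \<and>
      (\<forall>\<xi>>0. the_solution_exists_on (full_field a b c \<xi>) Q0 (Tstar (norm Q0))) \<and>
      the_solution_exists_on limit_field Q0 (Tstar (norm Q0)) \<and>
      (\<forall>Q R. (\<forall>\<xi>>0. solution_on (full_field a b c \<xi>) Q0 (Tstar (norm Q0)) (Q \<xi>)) \<and>
              solution_on limit_field Q0 (Tstar (norm Q0)) R \<longrightarrow>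
         ((\<lambda>\<xi>. SUP t\<in>{0..Tstar (norm Q0)}. norm (Q \<xi> t - R t)) \<longlongrightarrow> 0) at_top)"
      unfolding n_def[symmetric]
      by (intro conjI allI impI T(1) full_flow(1) conv) auto
  qed
qed

end
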